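(* Let $f:\mathbb{R}^n\to\mathbb{R}$ be a function of class $C^2$ whose gradient is Lipschitz continuous with constant $L>0$ and which is strongly convex with constant $\mu>0$. Let $x^*\in\mathbb{R}^n$ be the unique minimizer of $f$, and let $x_0\in\mathbb{R}^n$ be the starting point. Let $t\mapsto\tilde x(t)$ be the curve obtained by applying the following iterative procedure: - set $t_0=0$ and consider the forward solution of $\ddot{\tilde x}+\nabla f(\tilde x)=0$ with $\tilde x(t_0)=x_0$ and $\dot{\tilde x}(t_0)=0$; - for every $k\ge 1$, let $t_k$ be the instant when the mean dissipation $t\mapsto \frac{|\dot{\tilde x}(t)|^2}{2(t-t_{k-1})}$, $t>t_{k-1}$, attains a local maximum for the first time, and set $x_k=\tilde x(t_k)$; then consider the forward solution of $\ddot{\tilde x}+\nabla f(\tilde x)=0$ with $\tilde x(t_k)=x_k$ and $\dot{\tilde x}(t_k)=0$. Set $\mathcal{T}_R:=32\,\frac{L}{\mu\sqrt{\mu}}$. Then for every $t\ge 0$ the following inequality is satisfied: $$f(\tilde x(t))-f(x^* )\le\left(1+\frac{\mu}{L}\right)^{-\left\lfloor \frac{t}{\mathcal{T}_R}\right\rfloor}\bigl(f(x_0)-f(x^* )\bigr).$$ Moreover, the following upper bound holds for the length of the curve $t\mapsto\tilde x(t)$: $$\int_0^\infty|\dot{\tilde x}(t)|\,dt\le 4\sqrt2\,\frac{L}{\mu}\,\mathcal{T}_R\,\sqrt{f(x_0)-f(x^* )}.$$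
   Context: $|\cdot|$ is the Euclidean norm on $\mathbb{R}^n$ and $\lfloor\cdot\rfloor$ denotes the integer part. A function $f$ is strongly convex with constant $\mu>0$ if $x\mapsto f(x)-\frac12\mu|x|^2$ is convex. Restart time (Maximum Mean Dissipation): for the solution $x(\cdot)$ of $\ddot x+\nabla f(x)=0$ with given initial point $x(0)$ and $\dot x(0)=0$, let $E_K(t)=\frac12|\dot x(t)|^2$ be the kinetic energy, and let the mean dissipation be $r(t)=E_K(t)/t$ for $t>0$ and $r(0)=0$, so that $\dot r(t)=\frac{t\dot E_K(t)-E_K(t)}{t^2}$ for $t>0$. The criterion restarts the evolution when $r$ reaches a local maximum, and the restart time, measured from the start of the evolution, is $t_a=\inf\{t:\ t\dot E_K(t)-E_K(t)<0\}$. In the iterative procedure, each $t_k-t_{k-1}$ is this restart time for the evolution starting at $x_{k-1}$ with zero velocity. *)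

theory Defs
  imports "HOL-Analysis.Analysis"
begin

definition class_C2 :: "('a::euclidean_space \<Rightarrow> real) \<Rightarrow> bool" where
  "class_C2 f \<longleftrightarrow>
     (\<exists>(f' :: 'a \<Rightarrow> 'a \<Rightarrow>\<^sub>L real) (f'' :: 'a \<Rightarrow> 'a \<Rightarrow>\<^sub>L 'a \<Rightarrow>\<^sub>L real).
        (\<forall>x. (f has_derivative blinfun_apply (f' x)) (at x)) \<and>
        (\<forall>x. (f' has_derivative blinfun_apply (f'' x)) (at x)) \<and>
        continuous_on UNIV f'')"

definition gradient :: "('a::real_inner \<Rightarrow> real) \<Rightarrow> 'a \<Rightarrow> 'a" where
  "gradient f x = (THE D. GDERIV f x :> D)"

definition strongly_convex :: "real \<Rightarrow> ('a::real_inner \<Rightarrow> real) \<Rightarrow> bool" where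
  "strongly_convex \<mu> f \<longleftrightarrow> convex_on UNIV (\<lambda>x. f x - 1/2 * \<mu> * (norm x)\<^sup>2)"

(* The forward solution y of y'' + grad f (y) = 0 with y(0) = x and y'(0) = 0,
   given together with its velocity v. *)
definition rest_evolution ::
  "('a::real_inner \<Rightarrow> real) \<Rightarrow> 'a \<Rightarrow> (real \<Rightarrow> 'a) \<Rightarrow> (real \<Rightarrow> 'a) \<Rightarrow> bool" where
  "rest_evolution f x y v \<longleftrightarrow>
     y 0 = x \<and> v 0 = 0 \<and>
     (\<forall>t\<ge>0. (y has_vector_derivative v t) (at t within {0..}) \<and>
            (v has_vector_derivative - gradient f (y t)) (at t within {0..}))"

definition kinetic_energy :: "(real \<Rightarrow> 'a::real_normed_vector) \<Rightarrow> real \<Rightarrow> real" where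
  "kinetic_energy v t = 1/2 * (norm (v t))\<^sup>2"

(* First time at which r(t) = E_K(t) / t stops being nondecreasing, the sign of r' being that of
   t E_K'(t) - E_K(t). The value is \<infinity> if that never happens, e.g. for the constant evolution
   starting at a critical point. *)
definition restart_time :: "(real \<Rightarrow> 'a::real_normed_vector) \<Rightarrow> ereal" where
  "restart_time v =
     Inf (ereal ` {t. 0 < t \<and> t * deriv (kinetic_energy v) t - kinetic_energy v t < 0})"

(* The curve X produced by the restart procedure from x0, with restart instants T 0 = 0, T 1, ...
   If T (Suc k) = \<infinity>, the k-th evolution is never restarted and the procedure ends.
   Only the values of X on [0, sup T) are prescribed: neither the finiteness of the
   T k nor their divergence is assumed. *)
definition restart_curve ::
  "('a::real_inner \<Rightarrow> real) \<Rightarrow> 'a \<Rightarrow> (nat \<Rightarrow> ereal) \<Rightarrow> (real \<Rightarrow> 'a) \<Rightarrow> bool" where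
  "restart_curve f x0 T X \<longleftrightarrow>
     T 0 = 0 \<and> X 0 = x0 \<and>
     (\<forall>k. T k = \<infinity> \<longrightarrow> T (Suc k) = \<infinity>) \<and>
     (\<forall>k. T k < \<infinity> \<longrightarrow>
        (\<exists>y v. rest_evolution f (X (real_of_ereal (T k))) y v \<and>
               T (Suc k) = T k + restart_time v \<and>
               (\<forall>t. T k \<le> ereal t \<and> ereal t \<le> T (Suc k) \<longrightarrow>
                    X t = y (t - real_of_ereal (T k)))))"

end

theory Submission
  imports Defs
begin

text \<open>
  Write \<open>E\<close> for the kinetic energy and \<open>h(t) = t E'(t) - E(t)\<close>, so that
  \<open>h'(t) = t E''(t)\<close> and \<open>E'' \<ge> |\<nabla>f(y)|\<^sup>2 - L |v|\<^sup>2\<close>. At the restart time \<open>h\<close> leaves the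
  nonnegative reals, hence \<open>h' \<le> 0\<close> and \<open>|\<nabla>f(y)|\<^sup>2 \<le> 2 L E\<close> there. With the inequality
  \<open>|\<nabla>f|\<^sup>2 \<ge> 2 \<mu> (f - f(x\<^sup>*))\<close> and the conservation of \<open>E + f(y)\<close>, each evolution reduces the
  potential gap by the factor \<open>1 + \<mu> / L\<close>.

  On \<open>[0, s]\<close> with \<open>s = 1 / (2 sqrt L)\<close> the gradient varies by at most a third of its initial
  norm; hence \<open>h \<ge> 0\<close> on this interval, so no restart takes place before \<open>s\<close>, and \<open>E(s)\<close> is
  bounded below by a multiple of the gap. As \<open>E(t) / t\<close> is nondecreasing up to the restart and \<open>E\<close>
  is at most the gap, the restart time is at most \<open>9 sqrt L / (2 \<mu>)\<close>. The speed is at most the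
  square root of twice the gap, and summing over the evolutions bounds the length.
\<close>

section \<open>Gradients and Hessians of functions of class C2\<close>

lemma GDERIV_gradient:
  assumes "GDERIV f x :> D"
  shows "gradient f x = D"
  unfolding gradient_def
proof (rule the_equality[where P = "\<lambda>D. GDERIV f x :> D"])
  fix D' assume "GDERIV f x :> D'"
  then have "(\<lambda>h. h \<bullet> D') = (\<lambda>h. h \<bullet> D)"
    using assms unfolding gderiv_def by (rule has_derivative_unique)
  then show "D' = D"
    by (metis vector_eq_ldot)
qed (rule assms)

lemma has_derivative_gradient:
  fixes f :: "'a::euclidean_space \<Rightarrow> real"
  assumes "(f has_derivative f') (at x)"
  shows "gradient f x = (\<Sum>b\<in>Basis. f' b *\<^sub>R b)"
    and "GDERIV f x :> gradient f x"
proof -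
  interpret linear f'
    using assms by (rule has_derivative_linear)
  have "f' h = h \<bullet> (\<Sum>b\<in>Basis. f' b *\<^sub>R b)" for h
  proof -
    have "f' h = f' (\<Sum>b\<in>Basis. (h \<bullet> b) *\<^sub>R b)"
      by (simp add: euclidean_representation)
    also have "\<dots> = h \<bullet> (\<Sum>b\<in>Basis. f' b *\<^sub>R b)"
      by (simp add: sum scale inner_sum_right mult.commute)
    finally show ?thesis .
  qed
  then have "f' = (\<lambda>h. h \<bullet> (\<Sum>b\<in>Basis. f' b *\<^sub>R b))"
    by (rule ext)
  with assms have "GDERIV f x :> (\<Sum>b\<in>Basis. f' b *\<^sub>R b)"
    unfolding gderiv_def by simp
  then show "gradient f x = (\<Sum>b\<in>Basis. f' b *\<^sub>R b)" and "GDERIV f x :> gradient f x"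
    by (simp_all add: GDERIV_gradient)
qed

lemma class_C2_GDERIV:
  fixes f :: "'a::euclidean_space \<Rightarrow> real"
  assumes "class_C2 f"
  shows "GDERIV f x :> gradient f x"
  using assms has_derivative_gradient(2) unfolding class_C2_def by blast

text \<open>The coordinates of the gradient are the values of \<open>f'\<close> on the basis
  vectors, so differentiating \<open>f'\<close> as an operator-valued map differentiates the
  gradient coordinatewise.\<close>

lemma class_C2_hessian:
  fixes f :: "'a::euclidean_space \<Rightarrow> real"
  assumes "class_C2 f"
  obtains H where "\<And>x. (gradient f has_derivative H x) (at x)"
proof -
  obtain f' :: "'a \<Rightarrow> 'a \<Rightarrow>\<^sub>L real" and f'' :: "'a \<Rightarrow> 'a \<Rightarrow>\<^sub>L 'a \<Rightarrow>\<^sub>L real"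
    where f': "\<And>x. (f has_derivative blinfun_apply (f' x)) (at x)"
      and f'': "\<And>x. (f' has_derivative blinfun_apply (f'' x)) (at x)"
    using assms unfolding class_C2_def by blast
  have gradient: "gradient f = (\<lambda>x. \<Sum>b\<in>Basis. blinfun_apply (f' x) b *\<^sub>R b)"
    using has_derivative_gradient(1)[OF f'] by auto
  have "(gradient f has_derivative (\<lambda>u. \<Sum>b\<in>Basis. blinfun_apply (f'' x u) b *\<^sub>R b)) (at x)" for x
    unfolding gradient
    by (rule derivative_eq_intros refl f'' | simp add: blinfun.zero_right)+
  then show thesis
    by (rule that)
qed

section \<open>Mean value, Lipschitz and convexity estimates\<close>

lemma norm_vector_increment_le:
  fixes w :: "real \<Rightarrow> 'a::real_normed_vector"
  assumes "\<And>t. t \<in> {0..s} \<Longrightarrow> (w has_vector_derivative w' t) (at t within {0..})"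
    and "\<And>t. t \<in> {0..s} \<Longrightarrow> norm (w' t) \<le> B"
    and "t \<in> {0..s}"
  shows "norm (w t - w 0) \<le> B * t"
proof -
  have "norm (w t - w 0) \<le> B * norm (t - 0)"
  proof (rule differentiable_bound)
    fix r assume r: "r \<in> {0..s}"
    have "(w has_vector_derivative w' r) (at r within {0..s})"
      by (rule has_vector_derivative_within_subset[OF assms(1)[OF r]]) auto
    then show "(w has_derivative (\<lambda>h. h *\<^sub>R w' r)) (at r within {0..s})"
      by (simp add: has_vector_derivative_def)
    have "norm (h *\<^sub>R w' r) \<le> B * norm h" for h
      using mult_left_mono[OF assms(2)[OF r], of "\<bar>h\<bar>"] by (simp add: mult.commute)
    then show "onorm (\<lambda>h. h *\<^sub>R w' r) \<le> B"
      by (rule onorm_le)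
  qed (use assms(3) in auto)
  with assms(3) show ?thesis
    by simp
qed

text \<open>Compares \<open>F' u\<close> with the difference quotient along
  \<open>s *\<^sub>R u\<close> for one small \<open>s\<close>. The tolerance
  \<open>e / norm u\<close> is chosen so that the remainder becomes \<open>s * e\<close>, and
  dividing by \<open>s\<close> leaves the error \<open>e\<close>. Applied to the gradient, this
  bounds the Hessian by \<open>L\<close>.\<close>

lemma lipschitz_on_norm_derivative_le:
  fixes F :: "'a::real_normed_vector \<Rightarrow> 'b::real_normed_vector"
  assumes "L-lipschitz_on UNIV F" "(F has_derivative F') (at x)"
  shows "norm (F' u) \<le> L * norm u"
proof -
  interpret F': linear F'
    using assms(2) by (rule has_derivative_linear)
  show ?thesis
  proof (cases "u = 0")
    case False
    show ?thesis
    proof (rule field_le_epsilon)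
      fix e :: real assume "e > 0"
      with False have "e / norm u > 0"
        by simp
      then obtain d where "d > 0"
        and d: "\<And>y. norm (y - x) < d \<Longrightarrow> norm (F y - F x - F' (y - x)) \<le> e / norm u * norm (y - x)"
        using assms(2) unfolding has_derivative_at_alt by blast
      define s where "s = d / (2 * norm u)"
      have "s > 0" "norm (s *\<^sub>R u) < d"
        using \<open>d > 0\<close> False by (simp_all add: s_def)
      with d[of "x + s *\<^sub>R u"] have "norm (F (x + s *\<^sub>R u) - F x - s *\<^sub>R F' u) \<le> s * e"
        using False by (simp add: F'.scale mult.commute)
      moreover have "norm (F (x + s *\<^sub>R u) - F x) \<le> s * (L * norm u)"
        using lipschitz_onD[OF assms(1), of "x + s *\<^sub>R u" x] \<open>s > 0\<close>
        by (simp add: dist_norm mult_ac)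
      ultimately have "norm (s *\<^sub>R F' u) \<le> s * (L * norm u) + s * e"
        using norm_triangle_ineq4[of "F (x + s *\<^sub>R u) - F x" "F (x + s *\<^sub>R u) - F x - s *\<^sub>R F' u"]
        by simp
      then have "s * norm (F' u) \<le> s * (L * norm u + e)"
        using \<open>s > 0\<close> by (simp add: distrib_left)
      then show "norm (F' u) \<le> L * norm u + e"
        using \<open>s > 0\<close> by simp
    qed
  qed (simp add: F'.zero)
qed

text \<open>Restricted to the line through \<open>x\<close> and \<open>z\<close>, the convex
  function \<open>g\<close> lies above its tangent at parameter 0. Restoring the subtracted
  quadratic produces the term in \<open>norm (z - x)\<close>.\<close>

lemma strongly_convex_above_tangent:
  fixes f :: "'a::real_inner \<Rightarrow> real"
  assumes "strongly_convex \<mu> f" "GDERIV f x :> D"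
  shows "f x + (z - x) \<bullet> D + \<mu> / 2 * (norm (z - x))\<^sup>2 \<le> f z"
proof -
  define g where "g = (\<lambda>x. f x - 1/2 * \<mu> * (norm x)\<^sup>2)"
  define p where "p = (\<lambda>s::real. x + s *\<^sub>R (z - x))"
  have "convex_on UNIV (g \<circ> p)"
  proof (rule convex_onI)
    fix t a b :: real assume "0 < t" "t < 1"
    then have "g ((1 - t) *\<^sub>R p a + t *\<^sub>R p b) \<le> (1 - t) * g (p a) + t * g (p b)"
      using assms(1) unfolding strongly_convex_def g_def[symmetric]
      by (intro convex_onD) auto
    moreover have "(1 - t) *\<^sub>R p a + t *\<^sub>R p b = p ((1 - t) *\<^sub>R a + t *\<^sub>R b)"
      by (simp add: p_def algebra_simps)
    ultimately show "(g \<circ> p) ((1 - t) *\<^sub>R a + t *\<^sub>R b) \<le> (1 - t) * (g \<circ> p) a + t * (g \<circ> p) b"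
      by simp
  qed simp
  moreover have "((\<lambda>s. f (p s)) has_derivative (\<lambda>h. (h *\<^sub>R (z - x)) \<bullet> D)) (at 0)"
    by (rule has_derivative_compose[of p _ _ _ f])
       (use assms(2) in \<open>auto simp: p_def gderiv_def intro!: derivative_eq_intros\<close>)
  then have "((g \<circ> p) has_real_derivative (z - x) \<bullet> D - \<mu> * (x \<bullet> (z - x))) (at 0)"
    unfolding has_field_derivative_def o_def g_def power2_norm_eq_inner
    by (auto intro!: derivative_eq_intros simp: p_def fun_eq_iff algebra_simps inner_commute)
  ultimately have "(g \<circ> p) 1 - (g \<circ> p) 0 \<ge> ((z - x) \<bullet> D - \<mu> * (x \<bullet> (z - x))) * (1 - 0)"
    by (intro convex_on_imp_above_tangent[of UNIV]) (auto simp del: o_apply)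
  then show ?thesis
    by (simp add: g_def p_def power2_norm_eq_inner algebra_simps inner_commute)
qed

text \<open>One restart multiplies the root of the potential gap by at most
  \<open>(1 + q) powr (- 1 / 2) \<le> 1 - q / 4\<close> with \<open>q = \<mu> / L \<le> 1\<close>, so the bounds on the lengths of the
  pieces are dominated by a telescoping sum.\<close>
lemma sqrt_le_telescope:
  assumes "0 < q" "q \<le> 1" "(1 + q) * c \<le> d" "0 \<le> c"
  shows "sqrt d \<le> 4 / q * (sqrt d - sqrt (c::real))"
proof -
  have "0 \<le> q / 2 * (1 - q) + q\<^sup>2 / 16 * (1 + q)"
    using assms by simp
  also have "\<dots> = (1 - q / 4)\<^sup>2 * (1 + q) - 1"
    by (simp add: power2_eq_square field_simps)
  finally have "1 * c \<le> ((1 - q / 4)\<^sup>2 * (1 + q)) * c"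
    using assms(4) by (intro mult_right_mono) auto
  also have "\<dots> \<le> (1 - q / 4)\<^sup>2 * d"
    using assms(3) by (simp add: mult.assoc mult_left_mono)
  finally have "sqrt c \<le> sqrt ((1 - q / 4)\<^sup>2 * d)"
    by simp
  also have "\<dots> = (1 - q / 4) * sqrt d"
    using assms by (simp add: real_sqrt_mult)
  finally have "q / 4 * sqrt d \<le> sqrt d - sqrt c"
    by (simp add: algebra_simps)
  then show ?thesis
    using assms(1) by (simp add: field_simps)
qed

section \<open>Consequences of smoothness and strong convexity\<close>

locale smooth_strongly_convex =
  fixes f :: "'a::euclidean_space \<Rightarrow> real" and L \<mu> :: real and x_star :: 'a
  assumes C2: "class_C2 f"
    and L_pos: "L > 0" and lipschitz: "L-lipschitz_on UNIV (gradient f)"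
    and mu_pos: "\<mu> > 0" and strongly_convex: "strongly_convex \<mu> f"
    and minimizer: "\<And>x. f x_star \<le> f x"
begin

lemmas above_tangent = strongly_convex_above_tangent[OF strongly_convex class_C2_GDERIV[OF C2]]

lemma norm_gradient_diff_le: "norm (gradient f x - gradient f z) \<le> L * norm (x - z)"
  using lipschitz_onD[OF lipschitz] by (simp add: dist_norm)

text \<open>The tangent bound at \<open>x\<close>, evaluated at the minimizer, is quadratic in the
  distance \<open>?d\<close>; completing the square removes that distance.\<close>

lemma polyak_lojasiewicz: "2 * \<mu> * (f x - f x_star) \<le> (norm (gradient f x))\<^sup>2"
proof -
  let ?d = "norm (x_star - x)" and ?g = "norm (gradient f x)"
  have "f x - f x_star \<le> ?d * ?g - \<mu> / 2 * ?d\<^sup>2"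
    using above_tangent[of x x_star] Cauchy_Schwarz_ineq2[of "x_star - x" "gradient f x"] by linarith
  then have "2 * \<mu> * (f x - f x_star) \<le> 2 * \<mu> * (?d * ?g - \<mu> / 2 * ?d\<^sup>2)"
    using mu_pos by simp
  also have "\<dots> = ?g\<^sup>2 - (?g - \<mu> * ?d)\<^sup>2"
    by (simp add: power2_eq_square algebra_simps)
  finally show ?thesis
    using zero_le_power2[of "?g - \<mu> * ?d"] by linarith
qed

lemma gradient_minimizer: "gradient f x_star = 0"
proof -
  have "(\<lambda>h. h \<bullet> gradient f x_star) = (\<lambda>h. 0)"
    using class_C2_GDERIV[OF C2, of x_star] minimizer unfolding gderiv_def
    by (intro has_derivative_local_min) auto
  then show ?thesis
    by (metis inner_eq_zero_iff)
qed

lemma quadratic_growth: "f x_star + \<mu> / 2 * (norm (x - x_star))\<^sup>2 \<le> f x"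
  using above_tangent[of x_star x] by (simp add: gradient_minimizer)

lemma less_if_not_minimizer:
  assumes "x \<noteq> x_star"
  shows "f x_star < f x"
proof -
  have "0 < \<mu> / 2 * (norm (x - x_star))\<^sup>2"
    using assms mu_pos by simp
  with quadratic_growth[of x] show ?thesis
    by linarith
qed

text \<open>Quadratic growth and the tangent bound at \<open>x\<close> add up to strong monotonicity
  of the gradient between \<open>x\<close> and \<open>x_star\<close>, while the Lipschitz condition
  bounds the same inner product from above. The assumption keeps \<open>?d\<close> positive for the
  cancellation.\<close>

lemma mu_le_L:
  assumes "x \<noteq> x_star"
  shows "\<mu> \<le> L"
proof -
  let ?d = "norm (x - x_star)" and ?g = "gradient f x"
  have "\<mu> * ?d\<^sup>2 \<le> (x - x_star) \<bullet> ?g"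
    using quadratic_growth[of x] above_tangent[of x x_star]
    by (simp add: norm_minus_commute inner_diff_left algebra_simps)
  also have "\<dots> \<le> ?d * norm ?g"
    by (rule norm_cauchy_schwarz)
  also have "\<dots> \<le> ?d * (L * ?d)"
    using norm_gradient_diff_le[of x x_star] by (intro mult_left_mono) (simp_all add: gradient_minimizer)
  finally have "\<mu> * ?d\<^sup>2 \<le> L * ?d\<^sup>2"
    by (simp add: power2_eq_square mult_ac)
  then show ?thesis
    using assms by simp
qed

end

section \<open>A single evolution from rest: energy and mean dissipation\<close>

locale conservative_evolution = smooth_strongly_convex f L \<mu> x_star
  for f :: "'a::euclidean_space \<Rightarrow> real" and L \<mu> :: real and x_star :: 'a +
  fixes x :: 'a and y v :: "real \<Rightarrow> 'a"
  assumes evolution: "rest_evolution f x y v"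
begin

definition kinetic_power :: "real \<Rightarrow> real" where
  "kinetic_power t = - (v t \<bullet> gradient f (y t))"

lemma start: "y 0 = x" "v 0 = 0"
  using evolution by (auto simp: rest_evolution_def)

lemma position_derivative: "t \<ge> 0 \<Longrightarrow> (y has_vector_derivative v t) (at t within {0..})"
  and velocity_derivative:
    "t \<ge> 0 \<Longrightarrow> (v has_vector_derivative - gradient f (y t)) (at t within {0..})"
  using evolution by (auto simp: rest_evolution_def)

lemma kinetic_energy_derivative:
  assumes "t \<ge> 0"
  shows "(kinetic_energy v has_real_derivative kinetic_power t) (at t within {0..})"
  using velocity_derivative[OF assms]
  unfolding kinetic_energy_def power2_norm_eq_inner has_vector_derivative_def has_field_derivative_def
  by (auto intro!: derivative_eq_intros simp: kinetic_power_def fun_eq_iff inner_commute)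

lemma energy_conservation:
  assumes "t \<ge> 0"
  shows "kinetic_energy v t + f (y t) = f x"
proof -
  have "((\<lambda>t. kinetic_energy v t + f (y t)) has_real_derivative 0) (at s within {0..})" if "s \<ge> 0" for s
  proof -
    have "((\<lambda>t. f (y t)) has_derivative (\<lambda>h. (h *\<^sub>R v s) \<bullet> gradient f (y s))) (at s within {0..})"
      using position_derivative[OF that] class_C2_GDERIV[OF C2, of "y s"]
      unfolding has_vector_derivative_def gderiv_def by (rule has_derivative_compose)
    then have "((\<lambda>t. f (y t)) has_real_derivative - kinetic_power s) (at s within {0..})"
      unfolding has_field_derivative_def by (simp add: kinetic_power_def mult_commute_abs)
    from DERIV_add[OF kinetic_energy_derivative[OF that] this] show ?thesis
      by simp
  qed
  then obtain c where "\<And>s. s \<in> {0..} \<Longrightarrow> kinetic_energy v s + f (y s) = c"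
    using has_field_derivative_zero_constant[of "{0..}"] by force
  from this[of t] this[of 0] assms show ?thesis
    by (simp add: start kinetic_energy_def)
qed

text \<open>The derivative is the squared gradient norm minus the Hessian form at the velocity, and
  that form is at most \<open>L * (norm (v t))\<^sup>2\<close>. Only the resulting lower bound on
  \<open>e\<close> is exported, which hides the Hessian.\<close>

lemma kinetic_power_derivative:
  assumes "t \<ge> 0"
  obtains e where "(kinetic_power has_real_derivative e) (at t within {0..})"
    and "(norm (gradient f (y t)))\<^sup>2 - L * (norm (v t))\<^sup>2 \<le> e"
proof -
  obtain H where H: "\<And>x. (gradient f has_derivative H x) (at x)"
    using class_C2_hessian[OF C2] by blast
  interpret H: linear "H (y t)"
    using H by (rule has_derivative_linear)
  let ?e = "(norm (gradient f (y t)))\<^sup>2 - v t \<bullet> H (y t) (v t)"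
  have "((\<lambda>t. gradient f (y t)) has_derivative (\<lambda>h. H (y t) (h *\<^sub>R v t))) (at t within {0..})"
    using position_derivative[OF assms] H
    unfolding has_vector_derivative_def by (rule has_derivative_compose)
  with velocity_derivative[OF assms] have "(kinetic_power has_real_derivative ?e) (at t within {0..})"
    unfolding has_vector_derivative_def has_field_derivative_def kinetic_power_def power2_norm_eq_inner
    by (auto intro!: derivative_eq_intros simp: fun_eq_iff H.scale algebra_simps)
  moreover have "v t \<bullet> H (y t) (v t) \<le> norm (v t) * (L * norm (v t))"
    using norm_cauchy_schwarz[of "v t" "H (y t) (v t)"]
      mult_left_mono[OF lipschitz_on_norm_derivative_le[OF lipschitz H] norm_ge_zero]
    by (rule order_trans)
  then have "(norm (gradient f (y t)))\<^sup>2 - L * (norm (v t))\<^sup>2 \<le> ?e"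
    by (simp add: power2_eq_square mult_ac)
  ultimately show thesis
    by (rule that)
qed

text \<open>The sign of this function is the sign of the derivative of the mean dissipation.\<close>
definition excess_power :: "real \<Rightarrow> real" where
  "excess_power t = t * kinetic_power t - kinetic_energy v t"

text \<open>The product rule yields \<open>kinetic_power t\<close> once from the product and once,
  with opposite sign, from the kinetic energy; the two cancel.\<close>

lemma excess_power_derivative:
  assumes "t \<ge> 0"
  obtains e where "(excess_power has_real_derivative t * e) (at t within {0..})"
    and "(norm (gradient f (y t)))\<^sup>2 - L * (norm (v t))\<^sup>2 \<le> e"
proof -
  obtain e where e: "(kinetic_power has_real_derivative e) (at t within {0..})"
    "(norm (gradient f (y t)))\<^sup>2 - L * (norm (v t))\<^sup>2 \<le> e"
    using kinetic_power_derivative[OF assms] .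
  have "(excess_power has_real_derivative t * e) (at t within {0..})"
    unfolding excess_power_def
    by (rule derivative_eq_intros refl e kinetic_energy_derivative assms | simp)+
  with e(2) show thesis
    by (intro that)
qed

lemma continuous_on_excess_power: "continuous_on {0..} excess_power"
  unfolding continuous_on_eq_continuous_within
  using excess_power_derivative by (metis DERIV_continuous atLeast_iff)

lemma at_within_pos: "t > 0 \<Longrightarrow> at t within {0..} = at (t::real)"
  by (rule at_within_interior) (simp add: interior_real_atLeast)

text \<open>The restart criterion uses the two-sided \<open>deriv\<close>, whereas the evolution is
  differentiable within \<open>{0..}\<close>; the two agree at the positive times considered
  here.\<close>

lemma restart_time_excess_power:
  "restart_time v = Inf (ereal ` {t. 0 < t \<and> excess_power t < 0})"
proof -
  have "deriv (kinetic_energy v) t = kinetic_power t" if "t > 0" for t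
    using kinetic_energy_derivative[of t] that by (simp add: at_within_pos DERIV_imp_deriv)
  then show ?thesis
    unfolding restart_time_def excess_power_def by (intro arg_cong[where f = Inf]) auto
qed

lemma norm_velocity_le:
  assumes "t \<ge> 0"
  shows "norm (v t) \<le> sqrt (2 * (f x - f x_star))"
  using energy_conservation[OF assms] minimizer[of "y t"]
  by (intro real_le_rsqrt) (simp add: kinetic_energy_def)

lemma mean_dissipation_mono:
  assumes "0 < s" "s \<le> t" and "\<And>r. \<lbrakk>s \<le> r; r \<le> t\<rbrakk> \<Longrightarrow> excess_power r \<ge> 0"
  shows "kinetic_energy v s / s \<le> kinetic_energy v t / t"
proof (rule DERIV_nonneg_imp_nondecreasing[OF assms(2)])
  fix r assume r: "s \<le> r" "r \<le> t"
  with assms(1) have "r > 0" by simp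
  then have "((\<lambda>t. kinetic_energy v t / t) has_real_derivative excess_power r / r\<^sup>2) (at r)"
    using kinetic_energy_derivative[of r]
    by (auto intro!: derivative_eq_intros simp: at_within_pos excess_power_def power2_eq_square mult.commute)
  with assms(3)[OF r] show
    "\<exists>e. ((\<lambda>t. kinetic_energy v t / t) has_real_derivative e) (at r) \<and> 0 \<le> e"
    by (intro exI[of _ "excess_power r / r\<^sup>2"]) simp
qed

section \<open>Early phase of an evolution and bounds on its restart time\<close>

text \<open>A bootstrap on the largest displacement \<open>?D\<close> up to time \<open>s\<close>:
  the gradient stays below \<open>g + L * ?D\<close>, hence the speed below
  \<open>(g + L * ?D) * s\<close>, hence \<open>?D\<close> below
  \<open>(g + L * ?D) * s\<^sup>2\<close>. The choice of \<open>s\<close> makes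
  \<open>L * s\<^sup>2\<close> equal to 1/4.\<close>

lemma early_gradient_and_velocity:
  assumes t: "t \<in> {0..1 / (2 * sqrt L)}"
  shows "norm (gradient f (y t) - gradient f x) \<le> norm (gradient f x) / 3"
    and "norm (v t + t *\<^sub>R gradient f x) \<le> norm (gradient f x) / 3 * t"
proof -
  define s where "s = 1 / (2 * sqrt L)"
  define g where "g = norm (gradient f x)"
  have s: "s > 0" "L * s\<^sup>2 = 1 / 4"
    using L_pos by (auto simp: s_def power_mult_distrib power_divide)
  have "continuous_on {0..} y"
    unfolding continuous_on_eq_continuous_within
    using position_derivative has_vector_derivative_continuous by blast
  then have "continuous_on {0..s} (\<lambda>t. norm (y t - x))"
    by (intro continuous_intros) (auto elim: continuous_on_subset)
  then obtain m where m: "m \<in> {0..s}" "\<And>r. r \<in> {0..s} \<Longrightarrow> norm (y r - x) \<le> norm (y m - x)"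
    using continuous_attains_sup[of "{0..s}" "\<lambda>t. norm (y t - x)"] s(1) by force
  let ?D = "norm (y m - x)"
  have diff: "norm (gradient f (y r) - gradient f x) \<le> L * ?D" if "r \<in> {0..s}" for r
    using norm_gradient_diff_le[of "y r" x] mult_left_mono[OF m(2)[OF that], of L] L_pos by linarith
  have grad: "norm (gradient f (y r)) \<le> g + L * ?D" if "r \<in> {0..s}" for r
    using diff[OF that] norm_triangle_sub[of "gradient f (y r)" "gradient f x"] by (simp add: g_def)
  have nonneg: "g + L * ?D \<ge> 0"
    using L_pos by (simp add: g_def)
  have "norm (v r) \<le> (g + L * ?D) * s" if "r \<in> {0..s}" for r
  proof -
    have "norm (v r - v 0) \<le> (g + L * ?D) * r"
      by (rule norm_vector_increment_le[of s v "\<lambda>t. - gradient f (y t)"])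
         (use that velocity_derivative grad in auto)
    also have "\<dots> \<le> (g + L * ?D) * s"
      using that nonneg by (intro mult_left_mono) auto
    finally show ?thesis
      by (simp add: start)
  qed
  then have "norm (y m - y 0) \<le> (g + L * ?D) * s * m"
    using m(1) position_derivative by (intro norm_vector_increment_le[of s y v]) auto
  also have "\<dots> \<le> (g + L * ?D) * s * s"
    using m(1) nonneg s(1) by (intro mult_left_mono) auto
  finally have "L * ?D \<le> L * ((g + L * ?D) * s * s)"
    using L_pos by (simp add: start)
  also have "\<dots> = (g + L * ?D) * (L * s\<^sup>2)"
    by (simp add: power2_eq_square)
  \<comment> \<open>A quarter of \<open>L * ?D\<close> on the right is absorbed on the left, which
    turns 1/4 into 1/3.\<close>
  finally have D: "L * ?D \<le> g / 3"
    unfolding s(2) by simp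
  have *: "norm (gradient f (y r) - gradient f x) \<le> g / 3" if "r \<in> {0..s}" for r
    using diff[OF that] D by linarith
  then show "norm (gradient f (y t) - gradient f x) \<le> norm (gradient f x) / 3"
    using t by (simp add: s_def g_def)
  have "norm (v t + t *\<^sub>R gradient f x - (v 0 + 0 *\<^sub>R gradient f x)) \<le> g / 3 * t"
  proof (rule norm_vector_increment_le[of s "\<lambda>t. v t + t *\<^sub>R gradient f x"
        "\<lambda>t. - gradient f (y t) + gradient f x"])
    fix r assume r: "r \<in> {0..s}"
    then show "((\<lambda>t. v t + t *\<^sub>R gradient f x) has_vector_derivative
        - gradient f (y r) + gradient f x) (at r within {0..})"
      by (auto intro!: derivative_eq_intros velocity_derivative)
    show "norm (- gradient f (y r) + gradient f x) \<le> g / 3"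
      using *[OF r] by (simp add: norm_minus_commute)
  qed (use t in \<open>simp add: s_def\<close>)
  then show "norm (v t + t *\<^sub>R gradient f x) \<le> norm (gradient f x) / 3 * t"
    by (simp add: start g_def)
qed

text \<open>In the early phase the speed is at most \<open>4 / 3 * ?g * r\<close> and the gradient
  at least \<open>2 / 3 * ?g\<close>. With \<open>L * r\<^sup>2\<close> at most 1/4, the term
  \<open>L * (norm (v r))\<^sup>2\<close> is then at most \<open>(2 / 3 * ?g)\<^sup>2\<close>, so
  the function increases from its value 0.\<close>

lemma excess_power_nonneg_early:
  assumes t: "t \<in> {0..1 / (2 * sqrt L)}"
  shows "excess_power t \<ge> 0"
proof -
  let ?g = "norm (gradient f x)"
  have deriv: "\<exists>e. (excess_power has_real_derivative e) (at r) \<and> e \<ge> 0" if "0 < r" "r < t" for r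
  proof -
    have r: "r \<in> {0..1 / (2 * sqrt L)}"
      using t that by auto
    then have "0 \<le> r"
      by simp
    have "norm (v r) \<le> ?g * r + ?g / 3 * r"
      using early_gradient_and_velocity(2)[OF r]
        norm_triangle_ineq4[of "v r + r *\<^sub>R gradient f x" "r *\<^sub>R gradient f x"] that
      by (simp add: mult.commute)
    then have v: "norm (v r) \<le> 4 / 3 * ?g * r"
      by (simp add: field_simps)
    have "2 / 3 * ?g \<le> norm (gradient f (y r))"
      using early_gradient_and_velocity(1)[OF r]
        norm_triangle_sub[of "gradient f x" "gradient f (y r)"] by (simp add: norm_minus_commute)
    then have g: "(2 / 3 * ?g)\<^sup>2 \<le> (norm (gradient f (y r)))\<^sup>2"
      by (rule power_mono) simp
    have "r\<^sup>2 \<le> (1 / (2 * sqrt L))\<^sup>2"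
      using r by (intro power_mono) auto
    then have "L * r\<^sup>2 \<le> 1 / 4"
      using L_pos by (simp add: power_mult_distrib power_divide field_simps)
    have "L * (norm (v r))\<^sup>2 \<le> L * (4 / 3 * ?g * r)\<^sup>2"
      using L_pos v by (intro mult_left_mono power_mono) auto
    also have "\<dots> = (L * r\<^sup>2) * (4 / 3 * ?g)\<^sup>2"
      by (simp add: power2_eq_square)
    also have "\<dots> \<le> 1 / 4 * (4 / 3 * ?g)\<^sup>2"
      using \<open>L * r\<^sup>2 \<le> 1 / 4\<close> by (intro mult_right_mono) auto
    also have "\<dots> = (2 / 3 * ?g)\<^sup>2"
      by (simp add: power_mult_distrib power_divide)
    finally have "0 \<le> (norm (gradient f (y r)))\<^sup>2 - L * (norm (v r))\<^sup>2"
      using g by linarith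
    moreover obtain e where "(excess_power has_real_derivative r * e) (at r within {0..})"
      "(norm (gradient f (y r)))\<^sup>2 - L * (norm (v r))\<^sup>2 \<le> e"
      using excess_power_derivative[OF \<open>0 \<le> r\<close>] .
    ultimately show ?thesis
      using that(1) by (intro exI[of _ "r * e"]) (simp add: at_within_pos)
  qed
  have "continuous_on {0..t} excess_power"
    by (rule continuous_on_subset[OF continuous_on_excess_power]) auto
  then have "excess_power 0 \<le> excess_power t"
    using t by (intro DERIV_nonneg_imp_increasing_open[OF _ deriv]) simp_all
  then show ?thesis
    by (simp add: excess_power_def kinetic_energy_def start)
qed

text \<open>Up to the restart, the mean dissipation exceeds its value at an early time, while the kinetic
  energy never exceeds the initial potential gap.\<close>
lemma excess_power_nonneg_time_le:
  assumes "x \<noteq> x_star" "1 / (2 * sqrt L) \<le> t"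
    and "\<And>r. \<lbrakk>0 < r; r \<le> t\<rbrakk> \<Longrightarrow> excess_power r \<ge> 0"
  shows "t \<le> 9 * sqrt L / (2 * \<mu>)"
proof -
  define s where "s = 1 / (2 * sqrt L)"
  let ?g = "norm (gradient f x)" and ?G = "f x - f x_star"
  have s: "s > 0" "s \<le> t"
    using L_pos assms(2) by (simp_all add: s_def)
  have G: "?G > 0"
    using less_if_not_minimizer[OF assms(1)] by simp
  have "s * ?g \<le> norm (v s) + ?g / 3 * s"
    using early_gradient_and_velocity(2)[of s]
      norm_triangle_ineq4[of "v s + s *\<^sub>R gradient f x" "v s"] s L_pos
    by (simp add: s_def)
  then have "2 / 3 * ?g * s \<le> norm (v s)"
    by (simp add: field_simps)
  then have "(2 / 3 * ?g * s)\<^sup>2 \<le> (norm (v s))\<^sup>2"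
    using s(1) by (intro power_mono) auto
  then have "2 / 9 * s\<^sup>2 * ?g\<^sup>2 \<le> kinetic_energy v s"
    by (simp add: kinetic_energy_def power_mult_distrib power_divide mult_ac)
  \<comment> \<open>The Polyak-Lojasiewicz inequality replaces the initial gradient by the gap
    \<open>?G\<close>, which also bounds the later kinetic energy and therefore cancels.\<close>
  moreover have "2 / 9 * s\<^sup>2 * (2 * \<mu> * ?G) \<le> 2 / 9 * s\<^sup>2 * ?g\<^sup>2"
    using polyak_lojasiewicz[of x] by (intro mult_left_mono) auto
  moreover have "2 / 9 * s\<^sup>2 * (2 * \<mu> * ?G) = 4 / 9 * s\<^sup>2 * \<mu> * ?G"
    by simp
  ultimately have "4 / 9 * s\<^sup>2 * \<mu> * ?G \<le> kinetic_energy v s"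
    by linarith
  then have "4 / 9 * s\<^sup>2 * \<mu> * ?G / s \<le> kinetic_energy v s / s"
    using s(1) by (intro divide_right_mono) auto
  also have "\<dots> \<le> kinetic_energy v t / t"
    using s by (intro mean_dissipation_mono assms(3)) auto
  also have "\<dots> \<le> ?G / t"
    using energy_conservation[of t] minimizer[of "y t"] s by (intro divide_right_mono) auto
  also have "4 / 9 * s\<^sup>2 * \<mu> * ?G / s = 4 / 9 * s * \<mu> * ?G"
    using s(1) by (simp add: power2_eq_square)
  finally have "4 / 9 * s * \<mu> * ?G * t \<le> ?G"
    using s by (simp only: pos_le_divide_eq)
  then have "(4 / 9 * s * \<mu> * t) * ?G \<le> 1 * ?G"
    by (simp only: mult_ac mult_1)
  then have "4 / 9 * s * \<mu> * t \<le> 1"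
    using G by (simp only: mult_le_cancel_right_pos)
  then show ?thesis
    using L_pos mu_pos by (simp add: s_def field_simps)
qed

text \<open>Everything one evolution contributes to the procedure: its duration lies between two
  positive bounds, the gap contracts, and the endpoint is again not the minimizer, so the next
  evolution is restarted as well.\<close>

lemma restart_time_finite:
  assumes "x \<noteq> x_star"
  obtains \<tau> where "restart_time v = ereal \<tau>" "1 / (2 * sqrt L) \<le> \<tau>" "\<tau> \<le> 9 * sqrt L / (2 * \<mu>)"
    and "(1 + \<mu> / L) * (f (y \<tau>) - f x_star) \<le> f x - f x_star" "y \<tau> \<noteq> x_star"
proof -
  let ?s = "1 / (2 * sqrt L)" and ?B = "9 * sqrt L / (2 * \<mu>)"
  define S where "S = {t. 0 < t \<and> excess_power t < 0}"
  define \<tau> where "\<tau> = Inf S"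
  have S_ge: "?s \<le> t" if "t \<in> S" for t
  proof (rule ccontr)
    assume "\<not> ?s \<le> t"
    then show False
      using excess_power_nonneg_early[of t] that by (simp add: S_def)
  qed
  then have bdd: "bdd_below S"
    by (rule bdd_belowI)
  have nonempty: "S \<noteq> {}"
  proof
    assume "S = {}"
    then have "excess_power r \<ge> 0" if "r > 0" for r
      using that unfolding S_def by (metis (mono_tags) empty_Collect_eq not_less)
    \<comment> \<open>Without negative values the time bound would hold at every late instant; this
      one is past \<open>?s\<close> and exceeds \<open>?B\<close>.\<close>
    then have "max ?s (?B + 1) \<le> ?B"
      by (intro excess_power_nonneg_time_le assms) auto
    then show False
      by simp
  qed
  have "?s \<le> \<tau>"
    unfolding \<tau>_def using nonempty S_ge by (rule cInf_greatest)
  with L_pos have "\<tau> > 0"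
    by (smt (verit) divide_pos_pos real_sqrt_gt_zero)
  have before: "excess_power r \<ge> 0" if "0 < r" "r < \<tau>" for r
    using cInf_lower[OF _ bdd, of r] that by (force simp: S_def \<tau>_def)
  obtain e where e: "(excess_power has_real_derivative \<tau> * e) (at \<tau>)"
    "(norm (gradient f (y \<tau>)))\<^sup>2 - L * (norm (v \<tau>))\<^sup>2 \<le> e"
    using excess_power_derivative[OF less_imp_le[OF \<open>\<tau> > 0\<close>]]
    unfolding at_within_pos[OF \<open>\<tau> > 0\<close>] .
  \<comment> \<open>The infimum need not belong to \<open>S\<close>, so the sign at
    \<open>\<tau>\<close> comes from the limit from the left.\<close>
  have at_restart: "excess_power \<tau> \<ge> 0"
  proof (rule tendsto_lowerbound)
    show "(excess_power \<longlongrightarrow> excess_power \<tau>) (at_left \<tau>)"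
      using DERIV_isCont[OF e(1)] by (auto simp: isCont_def intro: tendsto_mono at_le)
    show "\<forall>\<^sub>F r in at_left \<tau>. 0 \<le> excess_power r"
      using eventually_at_left_real[OF \<open>\<tau> > 0\<close>] by eventually_elim (auto intro: before)
  qed simp
  \<comment> \<open>If \<open>e\<close> were positive, the function would be above its nonnegative
    value at \<open>\<tau>\<close> just after \<open>\<tau>\<close>, and \<open>S\<close> could not
    accumulate there.\<close>
  have "e \<le> 0"
  proof (rule ccontr)
    assume "\<not> e \<le> 0"
    with \<open>\<tau> > 0\<close> have "\<tau> * e > 0"
      by simp
    with e(1) obtain d where "d > 0" and d: "\<And>h. \<lbrakk>0 < h; h < d\<rbrakk> \<Longrightarrow> excess_power \<tau> < excess_power (\<tau> + h)"
      using DERIV_pos_inc_right by blast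
    obtain t where "t \<in> S" "t < \<tau> + d"
      using cInf_lessD[OF nonempty, of "\<tau> + d"] \<open>d > 0\<close> by (auto simp: \<tau>_def)
    moreover have "\<tau> \<le> t"
      unfolding \<tau>_def using \<open>t \<in> S\<close> bdd by (rule cInf_lower)
    ultimately show False
      using d[of "t - \<tau>"] at_restart by (cases "t = \<tau>") (auto simp: S_def)
  qed
  with e(2) have "2 * \<mu> * (f (y \<tau>) - f x_star) \<le> L * (norm (v \<tau>))\<^sup>2"
    using polyak_lojasiewicz[of "y \<tau>"] by linarith
  also have "(norm (v \<tau>))\<^sup>2 = 2 * (f x - f (y \<tau>))"
    using energy_conservation[of \<tau>] \<open>\<tau> > 0\<close> by (simp add: kinetic_energy_def)
  finally have "(1 + \<mu> / L) * (f (y \<tau>) - f x_star) \<le> f x - f x_star"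
    using L_pos by (simp add: field_simps)
  \<comment> \<open>At the minimizer the power vanishes, so nonnegativity of
    \<open>excess_power\<close> would force zero kinetic energy, and conservation would make the
    initial gap vanish.\<close>
  moreover have "y \<tau> \<noteq> x_star"
  proof
    assume "y \<tau> = x_star"
    with at_restart energy_conservation[of \<tau>] \<open>\<tau> > 0\<close> have "f x \<le> f x_star"
      by (simp add: excess_power_def kinetic_power_def gradient_minimizer)
    with less_if_not_minimizer[OF assms] show False
      by simp
  qed
  moreover have "restart_time v = ereal \<tau>"
    unfolding restart_time_excess_power S_def[symmetric] \<tau>_def
    using ereal_Inf'[OF bdd nonempty] by simp
  moreover have "\<tau> \<le> ?B"
    using assms \<open>?s \<le> \<tau>\<close>
  proof (rule excess_power_nonneg_time_le)
    show "excess_power r \<ge> 0" if "0 < r" "r \<le> \<tau>" for r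
      using before[of r] at_restart that by (cases "r = \<tau>") auto
  qed
  ultimately show thesis
    using \<open>?s \<le> \<tau>\<close> by (intro that)
qed

text \<open>A zero initial gap forces zero speed. The function \<open>excess_power\<close> then
  vanishes identically, and the infimum of the empty set is \<infinity>.\<close>

lemma stationary:
  assumes "x = x_star"
  shows "t \<ge> 0 \<Longrightarrow> y t = x_star" and "restart_time v = \<infinity>"
proof -
  have *: "v t = 0 \<and> y t = x_star" if "t \<ge> 0" for t
  proof -
    have "v t = 0"
      using norm_velocity_le[OF that] by (simp add: assms)
    then have "f (y t) = f x_star"
      using energy_conservation[OF that] by (simp add: assms kinetic_energy_def)
    with less_if_not_minimizer[of "y t"] \<open>v t = 0\<close> show ?thesis
      by auto
  qed
  then show "t \<ge> 0 \<Longrightarrow> y t = x_star"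
    by simp
  have "{t. 0 < t \<and> excess_power t < 0} = {}"
    using * by (auto simp: excess_power_def kinetic_power_def kinetic_energy_def)
  then show "restart_time v = \<infinity>"
    unfolding restart_time_excess_power by (simp only: image_empty Inf_empty top_ereal_def)
qed

end

section \<open>The restarted curve, piece by piece\<close>

locale conservative_restart = smooth_strongly_convex f L \<mu> x_star
  for f :: "'a::euclidean_space \<Rightarrow> real" and L \<mu> :: real and x_star :: 'a +
  fixes x0 :: 'a and T :: "nat \<Rightarrow> ereal" and X :: "real \<Rightarrow> 'a" and T_R :: real
  assumes curve: "restart_curve f x0 T X"
    and T_R: "T_R = 32 * (L / (\<mu> * sqrt \<mu>))"
begin

abbreviation gap :: "real \<Rightarrow> real" where
  "gap t \<equiv> f (X t) - f x_star"

text \<open>The derivative is two-sided, so its value is not controlled at 0 or at the restart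
  instants. Integrals over the pieces are insensitive to these points.\<close>

abbreviation speed :: "real \<Rightarrow> real" where
  "speed t \<equiv> norm (vector_derivative X (at t))"

lemma initial: "T 0 = ereal 0" "X 0 = x0"
  using curve by (auto simp: restart_curve_def zero_ereal_def)

lemma piece:
  assumes "T k = ereal a"
  obtains y v where "conservative_evolution f L \<mu> x_star (X a) y v"
    and "T (Suc k) = ereal a + restart_time v"
    and "\<And>t. \<lbrakk>a \<le> t; ereal t \<le> T (Suc k)\<rbrakk> \<Longrightarrow> X t = y (t - a)"
proof -
  from assms curve obtain y v where yv: "rest_evolution f (X a) y v"
    "T (Suc k) = ereal a + restart_time v"
    "\<And>t. \<lbrakk>a \<le> t; ereal t \<le> T (Suc k)\<rbrakk> \<Longrightarrow> X t = y (t - a)"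
    unfolding restart_curve_def by (metis ereal_less_eq(3) less_ereal.simps(4) real_of_ereal.simps(1))
  moreover have "conservative_evolution f L \<mu> x_star (X a) y v"
    using yv(1) by unfold_locales
  ultimately show thesis
    by (intro that)
qed

text \<open>Since \<open>\<mu> \<le> L\<close>, the product \<open>sqrt \<mu> * sqrt L\<close> is at
  most \<open>L\<close>, and 9/2 is below the constant 32 of \<open>T_R\<close>.\<close>

lemma restart_time_bound_le:
  assumes "x \<noteq> x_star"
  shows "9 * sqrt L / (2 * \<mu>) \<le> T_R"
proof -
  have "sqrt \<mu> * sqrt L \<le> sqrt L * sqrt L"
    using mu_le_L[OF assms] L_pos by (intro mult_right_mono) auto
  then have "sqrt \<mu> * sqrt L \<le> L"
    using L_pos by simp
  then have "9 / 2 * (sqrt \<mu> * sqrt L) \<le> 32 * L"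
    using L_pos by linarith
  then show ?thesis
    using mu_pos by (simp add: T_R field_simps)
qed

lemma piece_before_minimizer:
  assumes a: "T k = ereal a" "X a \<noteq> x_star"
  obtains b where "T (Suc k) = ereal b" "X b \<noteq> x_star"
    and "a + 1 / (2 * sqrt L) \<le> b" "b \<le> a + T_R"
    and "(1 + \<mu> / L) * gap b \<le> gap a"
    and "\<And>t. \<lbrakk>a \<le> t; t \<le> b\<rbrakk> \<Longrightarrow> gap t \<le> gap a"
    and "speed integrable_on {a..b}" "integral {a..b} speed \<le> T_R * sqrt (2 * gap a)"
proof -
  obtain y v where "conservative_evolution f L \<mu> x_star (X a) y v"
    and T: "T (Suc k) = ereal a + restart_time v"
    and Xy: "\<And>t. \<lbrakk>a \<le> t; ereal t \<le> T (Suc k)\<rbrakk> \<Longrightarrow> X t = y (t - a)"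
    using piece[OF a(1)] by blast
  interpret conservative_evolution f L \<mu> x_star "X a" y v
    by fact
  obtain \<tau> where \<tau>: "restart_time v = ereal \<tau>" "1 / (2 * sqrt L) \<le> \<tau>" "\<tau> \<le> 9 * sqrt L / (2 * \<mu>)"
    "(1 + \<mu> / L) * (f (y \<tau>) - f x_star) \<le> gap a" "y \<tau> \<noteq> x_star"
    using restart_time_finite[OF a(2)] .
  define b where "b = a + \<tau>"
  have Tb: "T (Suc k) = ereal b"
    by (simp add: T \<tau>(1) b_def)
  have \<tau>_le: "\<tau> \<le> T_R"
    using \<tau>(3) restart_time_bound_le[OF a(2)] by linarith
  have \<tau>_pos: "\<tau> > 0"
    using \<tau>(2) L_pos by (smt (verit) divide_pos_pos real_sqrt_gt_zero)
  have X: "X t = y (t - a)" if "a \<le> t" "t \<le> b" for t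
    using Xy that Tb by simp
  \<comment> \<open>The endpoints are left out because \<open>X\<close> is known to be a translate
    of \<open>y\<close> only on \<open>{a..b}\<close>, which gives no two-sided derivative
    there.\<close>
  have speed: "norm (v (t - a)) = speed t" if "t \<in> {a..b} - {a, b}" for t
  proof -
    have "(y has_vector_derivative v (t - a)) (at (t - a))"
      using position_derivative[of "t - a"] that by (simp add: at_within_pos)
    then have "((\<lambda>t. y (t - a)) has_vector_derivative v (t - a)) (at t)"
      by (auto intro!: vector_diff_chain_at[of "\<lambda>t. t - a" 1 t y "v (t - a)", unfolded o_def, simplified]
          derivative_eq_intros)
    then have "(X has_vector_derivative v (t - a)) (at t)"
      by (rule has_vector_derivative_transform_within_open[of _ _ _ "{a<..<b}"])
         (use that X in auto)
    then show ?thesis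
      by (simp add: vector_derivative_at)
  qed
  have "continuous_on {0..} v"
    unfolding continuous_on_eq_continuous_within
    using velocity_derivative has_vector_derivative_continuous by blast
  then have "continuous_on {a..b} (\<lambda>t. norm (v (t - a)))"
    by (rule continuous_on_norm[OF continuous_on_compose2[where s = "{a..b}"]])
       (auto intro: continuous_intros)
  then have int: "(\<lambda>t. norm (v (t - a))) integrable_on {a..b}"
    by (rule integrable_continuous_real)
  have integrable: "speed integrable_on {a..b}"
    by (rule integrable_spike_finite[OF _ _ int, of "{a, b}"]) (use speed in auto)
  have "integral {a..b} speed = integral {a..b} (\<lambda>t. norm (v (t - a)))"
    by (rule integral_spike[of "{a, b}"]) (use speed in auto)
  also have "\<dots> \<le> integral {a..b} (\<lambda>t. sqrt (2 * gap a))"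
    by (rule integral_le[OF int]) (use norm_velocity_le in auto)
  also have "\<dots> = \<tau> * sqrt (2 * gap a)"
    using \<tau>_pos by (simp add: b_def)
  also have "\<dots> \<le> T_R * sqrt (2 * gap a)"
    using \<tau>_le minimizer[of "X a"] by (intro mult_right_mono) auto
  finally have integral: "integral {a..b} speed \<le> T_R * sqrt (2 * gap a)" .
  have "gap t \<le> gap a" if "a \<le> t" "t \<le> b" for t
  proof -
    have "0 \<le> kinetic_energy v (t - a)"
      by (simp add: kinetic_energy_def)
    then show ?thesis
      using X[OF that] energy_conservation[of "t - a"] that by simp
  qed
  then show thesis
    using \<tau> \<tau>_le \<tau>_pos X[of b] Tb integrable integral by (intro that[of b]) (auto simp: b_def)
qed

lemma stationary_curve:
  assumes "x0 = x_star" "t \<ge> 0"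
  shows "X t = x_star"
proof -
  obtain y v where "conservative_evolution f L \<mu> x_star (X 0) y v"
    and T: "T (Suc 0) = ereal 0 + restart_time v"
    and Xy: "\<And>t. \<lbrakk>0 \<le> t; ereal t \<le> T (Suc 0)\<rbrakk> \<Longrightarrow> X t = y (t - 0)"
    using piece[OF initial(1)] by blast
  interpret conservative_evolution f L \<mu> x_star "X 0" y v
    by fact
  show ?thesis
    using Xy[of t] stationary(1)[of t] stationary(2) assms by (simp add: T initial)
qed

text \<open>By induction every restart instant is finite and no restart point is the minimizer, so
  \<open>piece_before_minimizer\<close> applies to every piece and real instants can replace
  extended ones.\<close>

lemma restart_instants:
  assumes "x0 \<noteq> x_star"
  defines "\<tau> \<equiv> \<lambda>k. real_of_ereal (T k)"
  shows "\<tau> 0 = 0"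
    and "\<tau> k + 1 / (2 * sqrt L) \<le> \<tau> (Suc k)" "\<tau> (Suc k) \<le> \<tau> k + T_R"
    and "(1 + \<mu> / L) * gap (\<tau> (Suc k)) \<le> gap (\<tau> k)"
    and "\<And>t. \<lbrakk>\<tau> k \<le> t; t \<le> \<tau> (Suc k)\<rbrakk> \<Longrightarrow> gap t \<le> gap (\<tau> k)"
    and "speed integrable_on {\<tau> k..\<tau> (Suc k)}"
    and "integral {\<tau> k..\<tau> (Suc k)} speed \<le> T_R * sqrt (2 * gap (\<tau> k))"
proof -
  have *: "T k = ereal (\<tau> k) \<and> X (\<tau> k) \<noteq> x_star" for k
  proof (induction k)
    case 0
    then show ?case
      using assms(1) by (simp add: \<tau>_def initial)
  next
    case (Suc k)
    then obtain b where "T (Suc k) = ereal b" "X b \<noteq> x_star"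
      using piece_before_minimizer[of k "\<tau> k"] by blast
    then show ?case
      by (simp add: \<tau>_def)
  qed
  then obtain b where b: "T (Suc k) = ereal b" "\<tau> k + 1 / (2 * sqrt L) \<le> b" "b \<le> \<tau> k + T_R"
    "(1 + \<mu> / L) * gap b \<le> gap (\<tau> k)" "\<And>t. \<lbrakk>\<tau> k \<le> t; t \<le> b\<rbrakk> \<Longrightarrow> gap t \<le> gap (\<tau> k)"
    "speed integrable_on {\<tau> k..b}" "integral {\<tau> k..b} speed \<le> T_R * sqrt (2 * gap (\<tau> k))"
    using piece_before_minimizer[of k "\<tau> k"] by blast
  moreover have "\<tau> (Suc k) = b"
    using b(1) by (simp add: \<tau>_def)
  ultimately show "\<tau> k + 1 / (2 * sqrt L) \<le> \<tau> (Suc k)" "\<tau> (Suc k) \<le> \<tau> k + T_R"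
    "(1 + \<mu> / L) * gap (\<tau> (Suc k)) \<le> gap (\<tau> k)"
    "\<And>t. \<lbrakk>\<tau> k \<le> t; t \<le> \<tau> (Suc k)\<rbrakk> \<Longrightarrow> gap t \<le> gap (\<tau> k)"
    "speed integrable_on {\<tau> k..\<tau> (Suc k)}"
    "integral {\<tau> k..\<tau> (Suc k)} speed \<le> T_R * sqrt (2 * gap (\<tau> k))"
    by simp_all
qed (simp add: \<tau>_def initial)

text \<open>Each evolution lasts at least \<open>?c\<close>, so the restarts cannot accumulate at a
  finite time and the pieces cover the half-line.\<close>

lemma restart_instants_unbounded:
  assumes "x0 \<noteq> x_star"
  obtains k where "t < real_of_ereal (T k)"
proof -
  let ?c = "1 / (2 * sqrt L)"
  have *: "real k * ?c \<le> real_of_ereal (T k)" for k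
  proof (induction k)
    case (Suc k)
    then show ?case
      using restart_instants(2)[OF assms, of k] by (simp add: algebra_simps add_divide_distrib)
  qed (simp add: initial)
  obtain k where "t < real k * ?c"
    using reals_Archimedean3[of ?c] L_pos by auto
  with *[of k] show thesis
    by (intro that[of k]) linarith
qed

section \<open>Decay of the gap and length of the curve\<close>

lemma gap_decay:
  assumes "t \<ge> 0"
  shows "gap t \<le> (1 + \<mu> / L) powi (- \<lfloor>t / T_R\<rfloor>) * (f x0 - f x_star)"
proof (cases "x0 = x_star")
  case True
  then show ?thesis
    using stationary_curve[OF True assms] by simp
next
  case False
  define \<tau> where "\<tau> k = real_of_ereal (T k)" for k
  note \<tau> = restart_instants[OF False, folded \<tau>_def]
  define q where "q = 1 + \<mu> / L"
  have q: "q \<ge> 1"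
    using L_pos mu_pos by (simp add: q_def)
  have T_R_pos: "T_R > 0"
    using L_pos mu_pos by (simp add: T_R)
  have decay: "gap (\<tau> k) \<le> inverse (q ^ k) * (f x0 - f x_star)" for k
  proof (induction k)
    case (Suc k)
    have "gap (\<tau> (Suc k)) \<le> gap (\<tau> k) / q"
      using \<tau>(4)[of k, folded q_def] q by (simp add: pos_le_divide_eq mult.commute)
    also have "\<dots> \<le> inverse (q ^ k) * (f x0 - f x_star) / q"
      using Suc q by (intro divide_right_mono) auto
    also have "\<dots> = inverse (q ^ Suc k) * (f x0 - f x_star)"
      by (simp add: divide_inverse)
    finally show ?case .
  qed (simp add: \<tau>(1) initial)
  have upper: "\<tau> k \<le> real k * T_R" for k
  proof (induction k)
    case (Suc k)
    then show ?case
      using \<tau>(3)[of k] by (simp add: algebra_simps)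
  qed (simp add: \<tau>(1))
  obtain n where "t < \<tau> n"
    using restart_instants_unbounded[OF False] by (auto simp: \<tau>_def)
  \<comment> \<open>The first restart instant after \<open>t\<close> is not the one with index 0, as
    \<open>\<tau> 0 = 0 \<le> t\<close>; its predecessor starts the piece containing
    \<open>t\<close>.\<close>
  then obtain k where k: "\<tau> k \<le> t" "t < \<tau> (Suc k)"
    using ex_least_nat_less[of "\<lambda>n. t < \<tau> n" n] assms by (auto simp: \<tau>(1) not_less)
  have "t / T_R < real (Suc k)"
    using k(2) upper[of "Suc k"] T_R_pos by (simp only: pos_divide_less_eq)
  \<comment> \<open>At least \<open>k\<close> restarts precede \<open>t\<close>, because
    \<open>k + 1\<close> pieces take at most \<open>(k + 1) * T_R\<close>. Since
    \<open>q \<ge> 1\<close>, the smaller floor only weakens the bound.\<close>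
  then have floor: "\<lfloor>t / T_R\<rfloor> \<le> int k"
    by linarith
  have "gap t \<le> gap (\<tau> k)"
    using \<tau>(5)[of k t] k by simp
  also have "\<dots> \<le> inverse (q ^ k) * (f x0 - f x_star)"
    by (rule decay)
  also have "inverse (q ^ k) = q powi (- int k)"
    by (simp add: power_int_minus)
  also have "q powi (- int k) * (f x0 - f x_star) \<le> q powi (- \<lfloor>t / T_R\<rfloor>) * (f x0 - f x_star)"
    using q floor minimizer[of x0] by (intro mult_right_mono power_int_increasing) auto
  finally show ?thesis
    unfolding q_def .
qed

text \<open>The length of each piece is at most \<open>C\<close> times the drop of
  \<open>sqrt (2 * gap)\<close> across it. The telescoped bound is uniform in the number of pieces,
  and monotone convergence carries it to the half-line.\<close>

lemma curve_length:
  "speed integrable_on {0..} \<and>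
    integral {0..} speed \<le> 4 * sqrt 2 * (L / \<mu>) * T_R * sqrt (f x0 - f x_star)"
proof (cases "x0 = x_star")
  case True
  text \<open>At \<open>0\<close> the curve has no prescribed two-sided derivative.\<close>
  have "speed t = 0" if "t \<in> {0..} - {0}" for t
  proof -
    have "(X has_vector_derivative 0) (at t)"
      by (rule has_vector_derivative_transform_within_open[of "\<lambda>_. x_star" _ _ "{0<..}"])
         (use that stationary_curve[OF True] in auto)
    then show ?thesis
      by (simp add: vector_derivative_at)
  qed
  then have "(speed has_integral 0) {0..}"
    using has_integral_spike_finite[of "{0}" "{0..}" speed "\<lambda>_. 0" 0] by auto
  then show ?thesis
    by (auto simp: has_integral_iff True)
next
  case False
  define \<tau> where "\<tau> k = real_of_ereal (T k)" for k
  note \<tau> = restart_instants[OF False, folded \<tau>_def]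
  define C where "C = 4 * (L / \<mu>) * T_R"
  have C: "C \<ge> 0"
    using L_pos mu_pos by (simp add: C_def T_R)
  have "\<mu> / L > 0" "\<mu> / L \<le> 1"
    using mu_pos L_pos mu_le_L[OF False] by simp_all
  have mono: "\<tau> k \<le> \<tau> (Suc k)" for k
    using \<tau>(2)[of k] L_pos by (smt (verit) divide_nonneg_pos real_sqrt_gt_zero)
  then have "incseq \<tau>"
    by (rule incseq_SucI)
  then have nonneg: "0 \<le> \<tau> k" for k
    using \<tau>(1) by (metis incseqD le0)
  have partial: "speed integrable_on {0..\<tau> k} \<and>
      integral {0..\<tau> k} speed \<le> C * (sqrt (2 * gap 0) - sqrt (2 * gap (\<tau> k)))" for k
  proof (induction k)
    case (Suc k)
    \<comment> \<open>The gaps enter doubled, as in the speed bound \<open>sqrt (2 * gap)\<close>;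
      this is the origin of the factor \<open>sqrt 2\<close> in the final estimate.\<close>
    have "T_R * sqrt (2 * gap (\<tau> k)) \<le>
        T_R * (4 / (\<mu> / L) * (sqrt (2 * gap (\<tau> k)) - sqrt (2 * gap (\<tau> (Suc k)))))"
    proof (intro mult_left_mono sqrt_le_telescope)
      show "(1 + \<mu> / L) * (2 * gap (\<tau> (Suc k))) \<le> 2 * gap (\<tau> k)"
        using \<tau>(4)[of k] by (subst mult.left_commute) simp
      show "0 \<le> 2 * gap (\<tau> (Suc k))"
        using minimizer by simp
      show "0 \<le> T_R"
        using L_pos mu_pos by (simp add: T_R)
    qed fact+
    then have "integral {\<tau> k..\<tau> (Suc k)} speed \<le>
        C * (sqrt (2 * gap (\<tau> k)) - sqrt (2 * gap (\<tau> (Suc k))))"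
      using \<tau>(7)[of k] by (simp add: C_def mult_ac)
    moreover have "speed integrable_on {0..\<tau> (Suc k)}"
      by (rule Henstock_Kurzweil_Integration.integrable_combine[OF nonneg[of k] mono[of k] _ \<tau>(6)]) (use Suc in blast)
    moreover from this have "integral {0..\<tau> (Suc k)} speed =
        integral {0..\<tau> k} speed + integral {\<tau> k..\<tau> (Suc k)} speed"
      by (intro Henstock_Kurzweil_Integration.integral_combine[symmetric] mono nonneg)
    ultimately show ?case
      using Suc by (simp add: algebra_simps)
  qed (use integrable_on_refl[of speed 0] in \<open>simp add: \<tau>(1)\<close>)
  let ?F = "\<lambda>k t. if t \<in> {0..\<tau> k} then speed t else 0"
  have sub: "{0..\<tau> k} \<inter> {0..} = {0..\<tau> k}" for k
    by auto
  have int_F: "integral {0..} (?F k) = integral {0..\<tau> k} speed" for k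
    unfolding integral_restrict_Int sub ..
  have bound: "integral {0..} (?F k) \<le> C * sqrt (2 * gap 0)" for k
  proof -
    have "C * (sqrt (2 * gap 0) - sqrt (2 * gap (\<tau> k))) \<le> C * sqrt (2 * gap 0)"
      using C minimizer[of "X (\<tau> k)"] by (intro mult_left_mono) auto
    then show ?thesis
      using partial[of k] unfolding int_F by linarith
  qed
  \<comment> \<open>The truncations \<open>?F k\<close> increase and, as the restart instants are
    unbounded, eventually equal \<open>speed\<close> at each point; convergence also yields
    integrability.\<close>
  have "speed integrable_on {0..} \<and> (\<lambda>k. integral {0..} (?F k)) \<longlonglongrightarrow> integral {0..} speed"
  proof (rule monotone_convergence_increasing)
    show "?F k integrable_on {0..}" for k
      unfolding integrable_restrict_Int sub using partial by blast
    show "?F k t \<le> ?F (Suc k) t" for k t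
      using mono[of k] by auto
    show "(\<lambda>k. ?F k t) \<longlonglongrightarrow> speed t" if "t \<in> {0..}" for t
    proof (rule tendsto_eventually)
      obtain n where "t < \<tau> n"
        using restart_instants_unbounded[OF False] by (auto simp: \<tau>_def)
      then have "t \<le> \<tau> k" if "n \<le> k" for k
        using incseqD[OF \<open>incseq \<tau>\<close> that] by linarith
      then show "\<forall>\<^sub>F k in sequentially. ?F k t = speed t"
        using that by (auto simp: eventually_sequentially)
    qed
    have "0 \<le> integral {0..} (?F k)" for k
      using partial[of k] unfolding int_F by (intro integral_nonneg) auto
    then show "bounded (range (\<lambda>k. integral {0..} (?F k)))"
      using bound by (intro boundedI[of _ "C * sqrt (2 * gap 0)"]) auto
  qed
  moreover from this have "integral {0..} speed \<le> C * sqrt (2 * gap 0)"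
    using bound by (blast intro: LIMSEQ_le_const2)
  moreover have "C * sqrt (2 * gap 0) = 4 * sqrt 2 * (L / \<mu>) * T_R * sqrt (f x0 - f x_star)"
    unfolding C_def initial real_sqrt_mult by simp
  ultimately show ?thesis
    by simp
qed

end

theorem theorem3p7:
  fixes f :: "real ^ 'n \<Rightarrow> real"
    and L \<mu> T_R :: real
    and x_star x0 :: "real ^ 'n"
    and T :: "nat \<Rightarrow> ereal"
    and X :: "real \<Rightarrow> real ^ 'n"
  assumes "class_C2 f"
    and "L > 0" and "L-lipschitz_on UNIV (gradient f)"
    and "\<mu> > 0" and "strongly_convex \<mu> f"
    and "\<forall>x. f x_star \<le> f x"
    and "restart_curve f x0 T X"
    and "T_R = 32 * (L / (\<mu> * sqrt \<mu>))"
  shows "(\<forall>t\<ge>0. f (X t) - f x_star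
            \<le> (1 + \<mu> / L) powi (- \<lfloor>t / T_R\<rfloor>) * (f x0 - f x_star))
       \<and> (\<lambda>t. norm (vector_derivative X (at t))) integrable_on {0..}
       \<and> integral {0..} (\<lambda>t. norm (vector_derivative X (at t)))
            \<le> 4 * sqrt 2 * (L / \<mu>) * T_R * sqrt (f x0 - f x_star)"
proof -
  interpret conservative_restart f L \<mu> x_star x0 T X T_R
    using assms by unfold_locales auto
  show ?thesis
    using gap_decay curve_length by blast
qed

end
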